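(* Let $n=3$ or $n=4$, let $X\subset\mathbb S_n$ be the conjugacy class of transpositions, and let $\mathcal{FK}_n=\mathfrak B(V)$ be the Nichols algebra of the Yetter-Drinfeld module $V=\Bbbk\{y_\eta:\eta\in X\}$ over $\Bbbk^{\mathbb S_n}$ with action and coaction $$\delta_\tau\cdot y_\eta=\delta_{\tau,\eta}\,y_\eta,\qquad y_\eta\mapsto\sum_{\omega\in\mathbb S_n}\mathrm{sign}(\omega)\,\delta_\omega\otimes y_{\omega^{-1}\eta\omega},\qquad\tau\in\mathbb S_n,\ \eta\in X.$$ Then $$J_n=1\otimes1+\sum_{\omega\in\mathbb S_n}\mathrm{sign}(\omega)\sum_{\eta,\tau\in X}y_\eta\delta_\omega\otimes y_{\omega^{-1}\tau\omega}$$ is a twist for the Hopf algebra $\mathcal{FK}_n\#\Bbbk^{\mathbb S_n}$.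
   Context: $\Bbbk$ is an algebraically closed field of characteristic zero. $\Bbbk^{\mathbb S_n}$ is the Hopf algebra of functions on the symmetric group $\mathbb S_n$, with basis of delta functions $\delta_\omega$ ($\omega\in\mathbb S_n$), and $\delta_{\tau,\eta}$ is the Kronecker delta. The Nichols algebra $\mathcal{FK}_n$ is finite-dimensional. For a Hopf algebra $R$ in ${}^H_H\mathcal{YD}$ (left-left Yetter-Drinfeld modules), the bosonization $R\#H$ is $R\otimes H$ with $(r\#h)(r'\#h')=r(h_{(1)}\cdot r')\#h_{(2)}h'$ and $\Delta(r\#h)=r_{(1)}\#r_{(2)(-1)}h_{(1)}\otimes r_{(2)(0)}\#h_{(2)}$; one writes $rh$ for $r\#h$. A twist for a Hopf algebra $K$ is an invertible $J\in K\otimes K$ with $(1\otimes J)(\mathrm{id}\otimes\Delta)(J)=(J\otimes1)(\Delta\otimes\mathrm{id})(J)$ and $(\mathrm{id}\otimes\epsilon)(J)=(\epsilon\otimes\mathrm{id})(J)=1$. *)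

theory Defs
  imports
    "HOL-Library.Poly_Mapping"
    "HOL-Combinatorics.Permutations"
    "HOL-Computational_Algebra.Polynomial"
begin

section \<open>Vector spaces with a chosen basis\<close>

text \<open>
  Every vector space over a field has a basis, so a vector space is given here by a basis
  \<open>B\<close> (a set, possibly infinite) and consists of the finitely supported functions on \<open>B\<close>.
  A linear map is given by its values on the basis, \<open>f :: 'a \<Rightarrow> ('b \<Rightarrow>\<^sub>0 'k)\<close>, and
  \<open>v \<bind> f\<close> is the value of its linear extension at \<open>v\<close>.  The tensor product of the
  spaces with bases \<open>A\<close> and \<open>B\<close> is the space with basis \<open>A \<times> B\<close>.

  Sweedler notation reads off directly: for \<open>\<Delta> :: 'a \<Rightarrow> ('a \<times> 'a \<Rightarrow>\<^sub>0 'k)\<close>, the vector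
  \<open>\<Delta> a \<bind> (\<lambda>(a1, a2). t a1 a2)\<close> is \<open>t\<close> (bilinearly extended) at \<open>a\<^sub>(\<^sub>1\<^sub>) \<otimes> a\<^sub>(\<^sub>2\<^sub>)\<close>.
\<close>

definition vec :: "'b set \<Rightarrow> ('b \<Rightarrow>\<^sub>0 'k::field) set" where
  "vec B = {v. Poly_Mapping.keys v \<subseteq> B}"

definition ket :: "'b \<Rightarrow> ('b \<Rightarrow>\<^sub>0 'k::field)" where
  "ket b = Poly_Mapping.single b 1"

definition cmul :: "'k \<Rightarrow> ('b \<Rightarrow>\<^sub>0 'k::field) \<Rightarrow> ('b \<Rightarrow>\<^sub>0 'k)" where
  "cmul c v = Poly_Mapping.map (\<lambda>x. c * x) v"

definition lin :: "('a \<Rightarrow>\<^sub>0 'k::field) \<Rightarrow> ('a \<Rightarrow> ('b \<Rightarrow>\<^sub>0 'k)) \<Rightarrow> ('b \<Rightarrow>\<^sub>0 'k)"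
    (infixl "\<bind>" 54) where
  "v \<bind> f = (\<Sum>a\<in>Poly_Mapping.keys v. cmul (Poly_Mapping.lookup v a) (f a))"

definition tensor :: "('a \<Rightarrow>\<^sub>0 'k::field) \<Rightarrow> ('b \<Rightarrow>\<^sub>0 'k) \<Rightarrow> ('a \<times> 'b \<Rightarrow>\<^sub>0 'k)"
    (infixr "\<otimes>" 72) where
  "u \<otimes> v = u \<bind> (\<lambda>a. v \<bind> (\<lambda>b. ket (a, b)))"

definition linear_map :: "'a set \<Rightarrow> 'b set \<Rightarrow> ('a \<Rightarrow> ('b \<Rightarrow>\<^sub>0 'k::field)) \<Rightarrow> bool" where
  "linear_map A B f \<longleftrightarrow> (\<forall>a\<in>A. f a \<in> vec B)"

definition assoc :: "('a \<times> 'b) \<times> 'c \<Rightarrow> ('a \<times> ('b \<times> 'c) \<Rightarrow>\<^sub>0 'k::field)" where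
  "assoc = (\<lambda>((a, b), c). ket (a, (b, c)))"

section \<open>Algebras, bialgebras, twists\<close>

record (overloaded) ('b, 'k) alg =
  basis :: "'b set"
  mult :: "'b \<times> 'b \<Rightarrow> ('b \<Rightarrow>\<^sub>0 'k)"
  unit_vec :: "'b \<Rightarrow>\<^sub>0 'k"

record (overloaded) ('b, 'k) bialg = "('b, 'k) alg" +
  comult :: "'b \<Rightarrow> ('b \<times> 'b \<Rightarrow>\<^sub>0 'k)"
  counit :: "'b \<Rightarrow> 'k"

definition mul :: "('b, 'k::field, 'z) alg_scheme \<Rightarrow> ('b \<Rightarrow>\<^sub>0 'k) \<Rightarrow> ('b \<Rightarrow>\<^sub>0 'k) \<Rightarrow> ('b \<Rightarrow>\<^sub>0 'k)" where
  "mul A u v = (u \<otimes> v) \<bind> mult A"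

definition is_algebra :: "('b, 'k::field, 'z) alg_scheme \<Rightarrow> bool" where
  "is_algebra A \<longleftrightarrow>
     linear_map (basis A \<times> basis A) (basis A) (mult A) \<and>
     unit_vec A \<in> vec (basis A) \<and>
     (\<forall>u\<in>vec (basis A). \<forall>v\<in>vec (basis A). \<forall>w\<in>vec (basis A).
        mul A (mul A u v) w = mul A u (mul A v w)) \<and>
     (\<forall>u\<in>vec (basis A). mul A (unit_vec A) u = u \<and> mul A u (unit_vec A) = u)"

definition is_coalgebra :: "('b, 'k::field, 'z) bialg_scheme \<Rightarrow> bool" where
  "is_coalgebra C \<longleftrightarrow>
     linear_map (basis C) (basis C \<times> basis C) (comult C) \<and>
     (\<forall>c\<in>basis C.
        (comult C c \<bind> (\<lambda>(c1, c2). comult C c1 \<otimes> ket c2)) \<bind> assoc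
          = comult C c \<bind> (\<lambda>(c1, c2). ket c1 \<otimes> comult C c2)) \<and>
     (\<forall>c\<in>basis C.
        comult C c \<bind> (\<lambda>(c1, c2). cmul (counit C c1) (ket c2)) = ket c \<and>
        comult C c \<bind> (\<lambda>(c1, c2). cmul (counit C c2) (ket c1)) = ket c)"

definition tensor_alg ::
    "('a, 'k::field, 'y) alg_scheme \<Rightarrow> ('b, 'k, 'z) alg_scheme \<Rightarrow> ('a \<times> 'b, 'k) alg" where
  "tensor_alg A B =
     \<lparr>basis = basis A \<times> basis B,
      mult = (\<lambda>((a, b), (a', b')). mult A (a, a') \<otimes> mult B (b, b')),
      unit_vec = unit_vec A \<otimes> unit_vec B\<rparr>"

text \<open>The two sides of the cocycle equation live in \<open>K \<otimes> (K \<otimes> K)\<close> and \<open>(K \<otimes> K) \<otimes> K\<close>.\<close>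

definition is_twist :: "('b, 'k::field, 'z) bialg_scheme \<Rightarrow> ('b \<times> 'b \<Rightarrow>\<^sub>0 'k) \<Rightarrow> bool" where
  "is_twist K J \<longleftrightarrow>
     J \<in> vec (basis K \<times> basis K) \<and>
     (\<exists>J'\<in>vec (basis K \<times> basis K).
        mul (tensor_alg K K) J J' = unit_vec K \<otimes> unit_vec K \<and>
        mul (tensor_alg K K) J' J = unit_vec K \<otimes> unit_vec K) \<and>
     mul (tensor_alg K (tensor_alg K K))
         (unit_vec K \<otimes> J) (J \<bind> (\<lambda>(x, y). ket x \<otimes> comult K y))
       = mul (tensor_alg (tensor_alg K K) K)
             (J \<otimes> unit_vec K) (J \<bind> (\<lambda>(x, y). comult K x \<otimes> ket y)) \<bind> assoc \<and>
     J \<bind> (\<lambda>(x, y). cmul (counit K y) (ket x)) = unit_vec K \<and>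
     J \<bind> (\<lambda>(x, y). cmul (counit K x) (ket y)) = unit_vec K"

section \<open>Left-left Yetter-Drinfeld modules\<close>

record (overloaded) ('m, 'h, 'k) yd =
  ybasis :: "'m set"
  act :: "'h \<times> 'm \<Rightarrow> ('m \<Rightarrow>\<^sub>0 'k)"
  coact :: "'m \<Rightarrow> ('h \<times> 'm \<Rightarrow>\<^sub>0 'k)"

text \<open>
  The last condition is
  \<open>h\<^sub>1 m\<^sub>-\<^sub>1 \<otimes> h\<^sub>2 \<cdot> m\<^sub>0 = (h\<^sub>1 \<cdot> m)\<^sub>-\<^sub>1 h\<^sub>2 \<otimes> (h\<^sub>1 \<cdot> m)\<^sub>0\<close>.
\<close>

definition is_yd :: "('h, 'k::field, 'z) bialg_scheme \<Rightarrow> ('m, 'h, 'k) yd \<Rightarrow> bool" where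
  "is_yd H M \<longleftrightarrow>
     linear_map (basis H \<times> ybasis M) (ybasis M) (act M) \<and>
     linear_map (ybasis M) (basis H \<times> ybasis M) (coact M) \<and>
     (\<forall>m\<in>ybasis M. unit_vec H \<bind> (\<lambda>h. act M (h, m)) = ket m) \<and>
     (\<forall>g\<in>basis H. \<forall>h\<in>basis H. \<forall>m\<in>ybasis M.
        mult H (g, h) \<bind> (\<lambda>x. act M (x, m)) = act M (h, m) \<bind> (\<lambda>x. act M (g, x))) \<and>
     (\<forall>m\<in>ybasis M. coact M m \<bind> (\<lambda>(g, m0). cmul (counit H g) (ket m0)) = ket m) \<and>
     (\<forall>m\<in>ybasis M.
        (coact M m \<bind> (\<lambda>(g, m0). comult H g \<otimes> ket m0)) \<bind> assoc
          = coact M m \<bind> (\<lambda>(g, m0). ket g \<otimes> coact M m0)) \<and>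
     (\<forall>h\<in>basis H. \<forall>m\<in>ybasis M.
        comult H h \<bind> (\<lambda>(h1, h2). coact M m \<bind> (\<lambda>(g, m0). mult H (h1, g) \<otimes> act M (h2, m0)))
          = comult H h \<bind> (\<lambda>(h1, h2). act M (h1, m) \<bind>
              (\<lambda>x. coact M x \<bind> (\<lambda>(g, x0). mult H (g, h2) \<otimes> ket x0))))"

definition yd_hom :: "('h, 'k::field, 'z) bialg_scheme \<Rightarrow> ('m, 'h, 'k) yd \<Rightarrow> ('n, 'h, 'k) yd
    \<Rightarrow> ('m \<Rightarrow> ('n \<Rightarrow>\<^sub>0 'k)) \<Rightarrow> bool" where
  "yd_hom H M N f \<longleftrightarrow>
     linear_map (ybasis M) (ybasis N) f \<and>
     (\<forall>h\<in>basis H. \<forall>m\<in>ybasis M. act M (h, m) \<bind> f = f m \<bind> (\<lambda>x. act N (h, x))) \<and>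
     (\<forall>m\<in>ybasis M. f m \<bind> coact N = coact M m \<bind> (\<lambda>(g, m0). ket g \<otimes> f m0))"

definition yd_tensor :: "('h, 'k::field, 'z) bialg_scheme \<Rightarrow> ('m, 'h, 'k) yd \<Rightarrow> ('n, 'h, 'k) yd
    \<Rightarrow> ('m \<times> 'n, 'h, 'k) yd" where
  "yd_tensor H M N =
     \<lparr>ybasis = ybasis M \<times> ybasis N,
      act = (\<lambda>(h, (m, n)). comult H h \<bind> (\<lambda>(h1, h2). act M (h1, m) \<otimes> act N (h2, n))),
      coact = (\<lambda>(m, n). coact M m \<bind> (\<lambda>(g, m0). coact N n \<bind>
                 (\<lambda>(g', n0). mult H (g, g') \<otimes> ket (m0, n0))))\<rparr>"

text \<open>The ground field, with basis \<open>{()}\<close>, as the unit object.\<close>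

definition yd_unit :: "('h, 'k::field, 'z) bialg_scheme \<Rightarrow> (unit, 'h, 'k) yd" where
  "yd_unit H =
     \<lparr>ybasis = {()},
      act = (\<lambda>(h, u). cmul (counit H h) (ket u)),
      coact = (\<lambda>u. unit_vec H \<otimes> ket u)\<rparr>"

section \<open>Braided Hopf algebras, Nichols algebras, bosonization\<close>

record (overloaded) ('b, 'h, 'k) yd_bialg = "('b, 'k) bialg" +
  ydmod :: "('b, 'h, 'k) yd"

text \<open>
  The algebra \<open>R \<otimes> R\<close> in the braided category, with the product twisted by the braiding
  \<open>m \<otimes> n \<mapsto> m\<^sub>-\<^sub>1 \<cdot> n \<otimes> m\<^sub>0\<close>:
  \<open>(r \<otimes> s)(r' \<otimes> s') = r (s\<^sub>-\<^sub>1 \<cdot> r') \<otimes> s\<^sub>0 s'\<close>.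
\<close>

definition braided_tensor_alg ::
    "('b, 'h, 'k::field, 'z) yd_bialg_scheme \<Rightarrow> ('b \<times> 'b, 'k) alg" where
  "braided_tensor_alg R =
     \<lparr>basis = basis R \<times> basis R,
      mult = (\<lambda>((r, s), (r', s')). coact (ydmod R) s \<bind> (\<lambda>(g, s0).
                mul R (ket r) (act (ydmod R) (g, r')) \<otimes> mult R (s0, s'))),
      unit_vec = unit_vec R \<otimes> unit_vec R\<rparr>"

definition is_yd_hopf ::
    "('h, 'k::field, 'y) bialg_scheme \<Rightarrow> ('b, 'h, 'k, 'z) yd_bialg_scheme \<Rightarrow> bool" where
  "is_yd_hopf H R \<longleftrightarrow>
     ybasis (ydmod R) = basis R \<and> is_yd H (ydmod R) \<and>
     is_algebra R \<and> is_coalgebra R \<and>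
     yd_hom H (yd_tensor H (ydmod R) (ydmod R)) (ydmod R) (mult R) \<and>
     yd_hom H (yd_unit H) (ydmod R) (\<lambda>_. unit_vec R) \<and>
     yd_hom H (ydmod R) (yd_tensor H (ydmod R) (ydmod R)) (comult R) \<and>
     yd_hom H (ydmod R) (yd_unit H) (\<lambda>r. cmul (counit R r) (ket ())) \<and>
     (\<forall>r\<in>basis R. \<forall>s\<in>basis R.
        mult R (r, s) \<bind> comult R = mul (braided_tensor_alg R) (comult R r) (comult R s)) \<and>
     unit_vec R \<bind> comult R = unit_vec R \<otimes> unit_vec R \<and>
     (\<forall>r\<in>basis R. \<forall>s\<in>basis R.
        mult R (r, s) \<bind> (\<lambda>x. cmul (counit R x) (ket ())) = cmul (counit R r * counit R s) (ket ())) \<and>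
     unit_vec R \<bind> (\<lambda>x. cmul (counit R x) (ket ())) = ket () \<and>
     (\<exists>S. yd_hom H (ydmod R) (ydmod R) S \<and>
        (\<forall>r\<in>basis R.
           comult R r \<bind> (\<lambda>(r1, r2). mul R (S r1) (ket r2)) = cmul (counit R r) (unit_vec R) \<and>
           comult R r \<bind> (\<lambda>(r1, r2). mul R (ket r1) (S r2)) = cmul (counit R r) (unit_vec R)))"

text \<open>
  A grading \<open>R = \<Oplus>\<^sub>n R(n)\<close> is given by a degree function on the basis, which is thus
  taken to be homogeneous.
\<close>

definition homogeneous :: "('b, 'k::field, 'z) alg_scheme \<Rightarrow> ('b \<Rightarrow> nat) \<Rightarrow> nat \<Rightarrow> ('b \<Rightarrow>\<^sub>0 'k) set" where
  "homogeneous R deg n = vec {b \<in> basis R. deg b = n}"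

definition is_graded_yd_hopf ::
    "('h, 'k::field, 'y) bialg_scheme \<Rightarrow> ('b, 'h, 'k, 'z) yd_bialg_scheme \<Rightarrow> ('b \<Rightarrow> nat) \<Rightarrow> bool" where
  "is_graded_yd_hopf H R deg \<longleftrightarrow>
     is_yd_hopf H R \<and>
     (\<forall>h\<in>basis H. \<forall>r\<in>basis R. act (ydmod R) (h, r) \<in> homogeneous R deg (deg r)) \<and>
     (\<forall>r\<in>basis R. coact (ydmod R) r \<in> vec (basis H \<times> {s \<in> basis R. deg s = deg r})) \<and>
     (\<forall>r\<in>basis R. \<forall>s\<in>basis R. mult R (r, s) \<in> homogeneous R deg (deg r + deg s)) \<and>
     unit_vec R \<in> homogeneous R deg 0 \<and>
     (\<forall>r\<in>basis R. comult R r \<in>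
        vec {(s, t). s \<in> basis R \<and> t \<in> basis R \<and> deg s + deg t = deg r}) \<and>
     (\<forall>r\<in>basis R. deg r > 0 \<longrightarrow> counit R r = 0)"

definition primitives :: "('b, 'k::field, 'z) bialg_scheme \<Rightarrow> ('b \<Rightarrow>\<^sub>0 'k) set" where
  "primitives R =
     {v \<in> vec (basis R). v \<bind> comult R = v \<otimes> unit_vec R + unit_vec R \<otimes> v}"

inductive_set generated_subalgebra ::
    "('b, 'k::field, 'z) alg_scheme \<Rightarrow> ('b \<Rightarrow>\<^sub>0 'k) set \<Rightarrow> ('b \<Rightarrow>\<^sub>0 'k) set"
  for A :: "('b, 'k::field, 'z) alg_scheme" and U :: "('b \<Rightarrow>\<^sub>0 'k) set" where
  gen: "u \<in> U \<Longrightarrow> u \<in> generated_subalgebra A U"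
| unit: "unit_vec A \<in> generated_subalgebra A U"
| add: "\<lbrakk>u \<in> generated_subalgebra A U; v \<in> generated_subalgebra A U\<rbrakk>
    \<Longrightarrow> u + v \<in> generated_subalgebra A U"
| scale: "u \<in> generated_subalgebra A U \<Longrightarrow> cmul c u \<in> generated_subalgebra A U"
| mult: "\<lbrakk>u \<in> generated_subalgebra A U; v \<in> generated_subalgebra A U\<rbrakk>
    \<Longrightarrow> mul A u v \<in> generated_subalgebra A U"

text \<open>
  \<open>R\<close>, graded by \<open>deg\<close>, is the Nichols algebra of \<open>V\<close>, where \<open>V\<close> is identified with
  \<open>R(1)\<close> through the isomorphism \<open>\<iota>\<close> of Yetter-Drinfeld modules.
\<close>

definition is_nichols_algebra ::
    "('h, 'k::field, 'y) bialg_scheme \<Rightarrow> ('v, 'h, 'k) yd \<Rightarrow> ('b, 'h, 'k, 'z) yd_bialg_scheme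
      \<Rightarrow> ('b \<Rightarrow> nat) \<Rightarrow> ('v \<Rightarrow> ('b \<Rightarrow>\<^sub>0 'k)) \<Rightarrow> bool" where
  "is_nichols_algebra H V R deg \<iota> \<longleftrightarrow>
     is_graded_yd_hopf H R deg \<and>
     homogeneous R deg 0 = {cmul c (unit_vec R) | c. True} \<and>
     yd_hom H V (ydmod R) \<iota> \<and>
     bij_betw (\<lambda>v. v \<bind> \<iota>) (vec (ybasis V)) (homogeneous R deg 1) \<and>
     primitives R = homogeneous R deg 1 \<and>
     generated_subalgebra R (homogeneous R deg 1) = vec (basis R)"

definition bosonization ::
    "('b, 'h, 'k::field, 'y) yd_bialg_scheme \<Rightarrow> ('h, 'k, 'z) bialg_scheme \<Rightarrow> ('b \<times> 'h, 'k) bialg" where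
  "bosonization R H =
     \<lparr>basis = basis R \<times> basis H,
      mult = (\<lambda>((r, h), (r', h')). comult H h \<bind> (\<lambda>(h1, h2).
                mul R (ket r) (act (ydmod R) (h1, r')) \<otimes> mult H (h2, h'))),
      unit_vec = unit_vec R \<otimes> unit_vec H,
      comult = (\<lambda>(r, h). comult R r \<bind> (\<lambda>(r1, r2). coact (ydmod R) r2 \<bind> (\<lambda>(g, r20).
                  comult H h \<bind> (\<lambda>(h1, h2).
                    (ket r1 \<otimes> mult H (g, h1)) \<otimes> (ket r20 \<otimes> ket h2))))),
      counit = (\<lambda>(r, h). counit R r * counit H h)\<rparr>"

section \<open>The function algebra of the symmetric group and the Fomin-Kirillov module\<close>

definition Sym :: "nat \<Rightarrow> (nat \<Rightarrow> nat) set" where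
  "Sym n = {p. p permutes {1..n}}"

definition transpositions :: "nat \<Rightarrow> (nat \<Rightarrow> nat) set" where
  "transpositions n = {transpose i j | i j. i \<in> {1..n} \<and> j \<in> {1..n} \<and> i \<noteq> j}"

text \<open>The Hopf algebra of functions on \<open>Sym n\<close>; \<open>ket \<omega>\<close> is the delta function at \<open>\<omega>\<close>.\<close>

definition fun_Sym :: "nat \<Rightarrow> (nat \<Rightarrow> nat, 'k::field) bialg" where
  "fun_Sym n =
     \<lparr>basis = Sym n,
      mult = (\<lambda>(\<sigma>, \<tau>). if \<sigma> = \<tau> then ket \<sigma> else 0),
      unit_vec = (\<Sum>\<omega>\<in>Sym n. ket \<omega>),
      comult = (\<lambda>\<omega>. \<Sum>(\<sigma>, \<tau>)\<in>{(\<sigma>, \<tau>) \<in> Sym n \<times> Sym n. \<sigma> \<circ> \<tau> = \<omega>}. ket (\<sigma>, \<tau>)),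
      counit = (\<lambda>\<omega>. if \<omega> = id then 1 else 0)\<rparr>"

text \<open>The module \<open>V\<close>; its basis vector \<open>y\<^sub>\<eta>\<close> is \<open>ket \<eta>\<close>.\<close>

definition FK_module :: "nat \<Rightarrow> (nat \<Rightarrow> nat, nat \<Rightarrow> nat, 'k::field) yd" where
  "FK_module n =
     \<lparr>ybasis = transpositions n,
      act = (\<lambda>(\<tau>, \<eta>). if \<tau> = \<eta> then ket \<eta> else 0),
      coact = (\<lambda>\<eta>. \<Sum>\<omega>\<in>Sym n.
                 cmul (of_int (sign \<omega>)) (ket \<omega> \<otimes> ket (inv \<omega> \<circ> \<eta> \<circ> \<omega>)))\<rparr>"

text \<open>
  \<open>y \<eta>\<close> is the image of \<open>y\<^sub>\<eta>\<close> in \<open>R\<close>; \<open>y\<^sub>\<eta> \<delta>\<^sub>\<omega>\<close> stands for \<open>y\<^sub>\<eta> # \<delta>\<^sub>\<omega>\<close> and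
  \<open>y\<^sub>\<eta>\<close> for \<open>y\<^sub>\<eta> # 1\<close>.
\<close>

definition FK_twist :: "nat \<Rightarrow> ('b, nat \<Rightarrow> nat, 'k::field, 'z) yd_bialg_scheme
    \<Rightarrow> ((nat \<Rightarrow> nat) \<Rightarrow> ('b \<Rightarrow>\<^sub>0 'k))
    \<Rightarrow> (('b \<times> (nat \<Rightarrow> nat)) \<times> ('b \<times> (nat \<Rightarrow> nat)) \<Rightarrow>\<^sub>0 'k)" where
  "FK_twist n R y =
     unit_vec (bosonization R (fun_Sym n)) \<otimes> unit_vec (bosonization R (fun_Sym n)) +
     (\<Sum>\<omega>\<in>Sym n. cmul (of_int (sign \<omega>))
       (\<Sum>\<eta>\<in>transpositions n. \<Sum>\<tau>\<in>transpositions n.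
          (y \<eta> \<otimes> ket \<omega>) \<otimes> (y (inv \<omega> \<circ> \<tau> \<circ> \<omega>) \<otimes> unit_vec (fun_Sym n :: (nat \<Rightarrow> nat, 'k) bialg))))"

end

theory Submission
  imports Defs
begin

text \<open>
  Conjugation by \<open>\<omega>\<close> permutes the transpositions, so the inner sum over \<open>\<tau>\<close> in the
  twist is the same for every \<open>\<omega>\<close>.  With \<open>a = \<Sum>\<^sub>\<eta> y\<^sub>\<eta>\<close> and
  \<open>\<chi> = \<Sum>\<^sub>\<omega> sign(\<omega>) \<delta>\<^sub>\<omega>\<close>, the sign character, the twist is just
  \<open>1 \<otimes> 1 + a\<chi> \<otimes> a\<close>.

  The pair \<open>(a, \<chi>)\<close> generates a copy of a quotient of Sweedler's Hopf algebra.  Indeed \<open>\<chi>\<close> is a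
  grouplike element of square 1.  The coaction on \<open>V\<close> conjugates the index and contributes a sign,
  so \<open>a\<close> is coacted on by \<open>\<chi>\<close> alone, which gives \<open>\<Delta>(a) = a \<otimes> 1 + \<chi> \<otimes> a\<close>; and
  transpositions are odd, so \<open>\<chi> a = - a \<chi>\<close>.  Finally \<open>a\<^sup>2 = 0\<close>: the braiding sends
  \<open>a \<otimes> a\<close> to \<open>- a \<otimes> a\<close>, hence \<open>a\<^sup>2\<close> is again primitive
  (\<open>anticommuting_primitive_square\<close>), but it has degree 2, while the primitive elements of a
  Nichols algebra have degree 1.

  These relations make \<open>(a\<chi> \<otimes> a)\<^sup>2 = 0\<close>, so \<open>1 \<otimes> 1 - a\<chi> \<otimes> a\<close> is inverse to the
  twist, and kill all the quadratic terms of the cocycle equation, whose two sides then agree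
  term by term (\<open>sweedler_twist\<close>, \<open>bosonization_twist\<close>).
\<close>

section \<open>Multilinear algebra\<close>

lemma lookup_cmul [simp]: "Poly_Mapping.lookup (cmul c v) b = c * Poly_Mapping.lookup v b"
  by (auto simp: cmul_def map.rep_eq when_def)

lemma cmul_simps [simp]:
  "cmul c 0 = 0" "cmul 1 v = v" "cmul c (cmul d v) = cmul (c * d) v"
  "cmul (- 1) v = - v" "cmul 0 v = 0"
  by (rule poly_mapping_eqI; simp add: mult.assoc)+

lemma cmul_add: "cmul c (u + v) = cmul c u + cmul c v"
  and cmul_add_left: "cmul (c + d) v = cmul c v + cmul d v"
  by (rule poly_mapping_eqI; simp add: lookup_add algebra_simps)+

lemma cmul_sum: "cmul c (sum f S) = (\<Sum>s\<in>S. cmul c (f s))"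
  by (induction S rule: infinite_finite_induct) (auto simp: cmul_add)

lemma lin_expand:
  assumes "finite S" "Poly_Mapping.keys v \<subseteq> S"
  shows "v \<bind> f = (\<Sum>a\<in>S. cmul (Poly_Mapping.lookup v a) (f a))"
  unfolding lin_def using assms
  by (intro sum.mono_neutral_left) (auto simp: in_keys_iff)

lemma lin_zero [simp]: "0 \<bind> f = 0"
  by (simp add: lin_def)

lemma lin_ket [simp]: "ket a \<bind> f = f a"
  by (simp add: lin_def ket_def)

lemma lin_cmul [simp]: "cmul c v \<bind> f = cmul c (v \<bind> f)"
proof -
  have "Poly_Mapping.keys (cmul c v) \<subseteq> Poly_Mapping.keys v"
    by (auto simp: in_keys_iff)
  then show ?thesis
    by (simp add: lin_expand[of "Poly_Mapping.keys v" "cmul c v"] lin_def[of v] cmul_sum)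
qed

lemma lin_add [simp]: "(u + v) \<bind> f = (u \<bind> f) + (v \<bind> f)"
proof -
  let ?S = "Poly_Mapping.keys u \<union> Poly_Mapping.keys v"
  have "Poly_Mapping.keys (u + v) \<subseteq> ?S"
    by (rule keys_add)
  then show ?thesis
    by (simp add: lin_expand[of ?S] lookup_add cmul_add_left sum.distrib)
qed

lemma lin_sum: "sum g S \<bind> f = (\<Sum>s\<in>S. g s \<bind> f)"
  by (induction S rule: infinite_finite_induct) auto

lemma lin_fun_zero [simp]: "v \<bind> (\<lambda>_. 0) = 0"
  by (simp add: lin_def)

lemma lin_fun_cmul: "v \<bind> (\<lambda>a. cmul c (f a)) = cmul c (v \<bind> f)"
  by (simp add: lin_def cmul_sum mult.commute)

lemma lin_fun_add: "v \<bind> (\<lambda>a. f a + g a) = (v \<bind> f) + (v \<bind> g)"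
  by (simp add: lin_def cmul_add sum.distrib)

lemma lin_assoc: "v \<bind> f \<bind> g = v \<bind> (\<lambda>a. f a \<bind> g)"
  by (simp add: lin_def[of v] lin_sum)

lemma lin_swap: "u \<bind> (\<lambda>a. v \<bind> (\<lambda>b. f a b)) = v \<bind> (\<lambda>b. u \<bind> (\<lambda>a. f a b))"
  by (simp add: lin_def[of u] lin_def[of v] cmul_sum mult.commute) (rule sum.swap)

lemma lin_ket_right: "v \<bind> ket = v"
proof (rule poly_mapping_eqI)
  fix b
  show "Poly_Mapping.lookup (v \<bind> ket) b = Poly_Mapping.lookup v b"
    by (simp add: lin_def lookup_sum ket_def lookup_single when_def in_keys_iff
        sum.delta if_distrib cong: if_cong)
qed

lemma lin_cong:
  assumes "v \<in> vec B" "\<And>b. b \<in> B \<Longrightarrow> f b = g b"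
  shows "v \<bind> f = v \<bind> g"
  using assms unfolding lin_def vec_def by (auto intro!: sum.cong)

lemma lin_tensor: "(u \<otimes> v) \<bind> f = u \<bind> (\<lambda>a. v \<bind> (\<lambda>b. f (a, b)))"
  by (simp add: tensor_def lin_assoc)

lemma tensor_simps [simp]:
  "0 \<otimes> v = 0" "u \<otimes> 0 = 0"
  "cmul c u \<otimes> v = cmul c (u \<otimes> v)" "u \<otimes> cmul c v = cmul c (u \<otimes> v)"
  by (simp_all add: tensor_def lin_fun_cmul)

lemma tensor_uminus: "(- u) \<otimes> v = - (u \<otimes> v)"
  using tensor_simps(3)[of "- 1" u v] by (simp del: tensor_simps)

lemma tensor_add: "(u + u') \<otimes> v = u \<otimes> v + u' \<otimes> v"
  and tensor_add_right: "u \<otimes> (v + v') = u \<otimes> v + u \<otimes> v'"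
  by (simp_all add: tensor_def lin_fun_add)

lemma tensor_sum_right: "u \<otimes> sum g T = (\<Sum>t\<in>T. u \<otimes> g t)"
  by (induction T rule: infinite_finite_induct) (auto simp: tensor_add_right)

lemma tensor_sum: "sum f S \<otimes> v = (\<Sum>s\<in>S. f s \<otimes> v)"
  by (induction S rule: infinite_finite_induct) (auto simp: tensor_add)

lemma lin_tensor_left: "(u \<bind> f) \<otimes> v = u \<bind> (\<lambda>a. f a \<otimes> v)"
  by (simp add: tensor_def lin_assoc)

lemma lin_tensor_right: "v \<otimes> (u \<bind> f) = u \<bind> (\<lambda>a. v \<otimes> f a)"
  by (simp add: tensor_def lin_assoc lin_swap[of v])

lemma ket_tensor_ket [simp]: "ket a \<otimes> ket b = ket (a, b)"
  by (simp add: tensor_def)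

lemma tensor_assoc: "((u \<otimes> v) \<otimes> w) \<bind> assoc = u \<otimes> v \<otimes> w"
  by (simp add: tensor_def lin_assoc assoc_def)

lemma vec_zero [simp]: "0 \<in> vec B"
  and vec_ket [simp]: "ket b \<in> vec B \<longleftrightarrow> b \<in> B"
  by (auto simp: vec_def ket_def)

lemma vec_add: "u \<in> vec B \<Longrightarrow> v \<in> vec B \<Longrightarrow> u + v \<in> vec B"
  using keys_add[of u v] by (auto simp: vec_def)

lemma vec_cmul: "v \<in> vec B \<Longrightarrow> cmul c v \<in> vec B"
  by (auto simp: vec_def in_keys_iff)

lemma vec_sum: "(\<And>s. s \<in> S \<Longrightarrow> f s \<in> vec B) \<Longrightarrow> sum f S \<in> vec B"
  by (induction S rule: infinite_finite_induct) (auto simp: vec_add)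

lemma vec_lin: "v \<in> vec A \<Longrightarrow> (\<And>a. a \<in> A \<Longrightarrow> f a \<in> vec B) \<Longrightarrow> v \<bind> f \<in> vec B"
  unfolding lin_def by (intro vec_sum vec_cmul) (auto simp: vec_def)

lemma vec_tensor: "u \<in> vec A \<Longrightarrow> v \<in> vec B \<Longrightarrow> u \<otimes> v \<in> vec (A \<times> B)"
  unfolding tensor_def by (intro vec_lin[of _ A] vec_lin[of _ B]) auto

lemma mul_lin: "mul A u v = u \<bind> (\<lambda>a. v \<bind> (\<lambda>b. mult A (a, b)))"
  by (simp add: mul_def lin_tensor)

lemma mul_simps [simp]:
  "mul A 0 v = 0" "mul A u 0 = 0"
  "mul A (cmul c u) v = cmul c (mul A u v)" "mul A u (cmul c v) = cmul c (mul A u v)"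
  by (simp_all add: mul_def)

lemma mul_add: "mul A (u + u') v = mul A u v + mul A u' v"
  and mul_add_right: "mul A u (v + v') = mul A u v + mul A u v'"
  by (simp_all add: mul_def tensor_add tensor_add_right)

lemma mul_uminus_right: "mul A u (- v) = - mul A u v"
  using mul_simps(4)[of A u "- 1" v] by (simp del: mul_simps)

lemma mul_tensor_alg:
  "mul (tensor_alg A B) (u \<otimes> v) (u' \<otimes> v') = mul A u u' \<otimes> mul B v v'"
  by (simp add: mul_lin lin_tensor lin_tensor_left tensor_alg_def)
     (simp add: lin_tensor_right lin_swap[of v u'])

lemma mul_lin_lin: "mul A (u \<bind> f) (v \<bind> g) = u \<bind> (\<lambda>a. v \<bind> (\<lambda>b. mul A (f a) (g b)))"
  by (simp add: mul_def lin_tensor_left lin_assoc) (simp add: lin_tensor_right lin_assoc)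

text \<open>
  The linear extension of the counit, with values in the ground field realised as the space with
  basis \<open>{()}\<close>: in this form it composes with the other linear maps.
\<close>

definition eps :: "('b, 'k::field, 'z) bialg_scheme \<Rightarrow> ('b \<Rightarrow>\<^sub>0 'k) \<Rightarrow> (unit \<Rightarrow>\<^sub>0 'k)" where
  "eps C v = v \<bind> (\<lambda>b. cmul (counit C b) (ket ()))"

lemma lin_counit: "v \<bind> (\<lambda>b. cmul (counit C b) w) = eps C v \<bind> (\<lambda>_. w)"
  by (simp add: eps_def lin_assoc)

section \<open>The twist on a copy of the Sweedler algebra\<close>

text \<open>
  In the intended application \<open>c\<close> is grouplike of square 1, \<open>z\<close> is skew primitive and
  anticommutes with \<open>c\<close>, and \<open>x = z c\<close>.  The hypotheses are the values of the structure maps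
  that occur in the twist conditions.  Every quadratic term of the inverse and of the cocycle
  equation has \<open>x x\<close>, \<open>x z\<close>, \<open>z x\<close> or \<open>z z\<close> as one of its tensor factors, and what remains on
  both sides of the latter is \<open>1 \<otimes> 1 \<otimes> 1 + x \<otimes> z \<otimes> 1 + x \<otimes> c \<otimes> z + 1 \<otimes> x \<otimes> z\<close>.
\<close>

lemma sweedler_twist:
  fixes K :: "('b, 'k::field, 'z) bialg_scheme"
  defines "e \<equiv> unit_vec K"
  assumes vec: "e \<in> vec (basis K)" "x \<in> vec (basis K)" "z \<in> vec (basis K)"
    and unit: "\<And>u. u \<in> {e, x, z, c} \<Longrightarrow> mul K e u = u"
              "\<And>u. u \<in> {e, x, z} \<Longrightarrow> mul K u e = u"
    and nil: "mul K x x = 0" "mul K x z = 0" "mul K z x = 0" "mul K z z = 0"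
    and comult_e: "e \<bind> comult K = e \<otimes> e"
    and comult_z: "z \<bind> comult K = z \<otimes> e + c \<otimes> z"
    and comult_x: "x \<bind> comult K = x \<otimes> c + e \<otimes> x"
    and counit_e: "eps K e = ket ()"
    and counit_x: "eps K x = 0"
    and counit_z: "eps K z = 0"
  shows "is_twist K (e \<otimes> e + x \<otimes> z)"
proof -
  let ?KK = "tensor_alg K K"
  note bilinear = mul_add mul_add_right mul_tensor_alg tensor_add tensor_add_right
  have in_vec: "e \<otimes> e + x \<otimes> z \<in> vec (basis K \<times> basis K)"
    "e \<otimes> e + cmul (- 1) (x \<otimes> z) \<in> vec (basis K \<times> basis K)"
    by (intro vec_add vec_tensor vec_cmul vec)+
  \<comment> \<open>\<open>-1\<close> is kept as a scalar, so that bilinearity also covers the difference\<close>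
  have inverse:
    "mul ?KK (e \<otimes> e + x \<otimes> z) (e \<otimes> e + cmul (- 1) (x \<otimes> z)) = e \<otimes> e"
    "mul ?KK (e \<otimes> e + cmul (- 1) (x \<otimes> z)) (e \<otimes> e + x \<otimes> z) = e \<otimes> e"
    by (simp_all del: cmul_simps(4) add: bilinear unit nil) (simp_all)
  have right: "(e \<otimes> e + x \<otimes> z) \<bind> (\<lambda>(x, y). ket x \<otimes> comult K y)
      = e \<otimes> e \<otimes> e + x \<otimes> z \<otimes> e + x \<otimes> c \<otimes> z"
  proof -
    have split: "(u \<otimes> v) \<bind> (\<lambda>(x, y). ket x \<otimes> comult K y) = u \<otimes> (v \<bind> comult K)" for u v
      by (simp add: lin_tensor lin_tensor_right[symmetric] lin_tensor_left[symmetric] lin_ket_right)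
    show ?thesis
      by (simp add: split comult_e comult_z bilinear add.assoc)
  qed
  have left: "(e \<otimes> e + x \<otimes> z) \<bind> (\<lambda>(x, y). comult K x \<otimes> ket y)
      = (e \<otimes> e) \<otimes> e + (x \<otimes> c) \<otimes> z + (e \<otimes> x) \<otimes> z"
  proof -
    have split: "(u \<otimes> v) \<bind> (\<lambda>(x, y). comult K x \<otimes> ket y) = (u \<bind> comult K) \<otimes> v" for u v
      by (simp add: lin_tensor lin_tensor_right[symmetric] lin_tensor_left[symmetric] lin_ket_right)
    show ?thesis
      by (simp add: split comult_e comult_x bilinear add.assoc)
  qed
  have cocycle:
    "mul (tensor_alg K ?KK) (e \<otimes> (e \<otimes> e + x \<otimes> z))
        (e \<otimes> e \<otimes> e + x \<otimes> z \<otimes> e + x \<otimes> c \<otimes> z)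
     = mul (tensor_alg ?KK K) ((e \<otimes> e + x \<otimes> z) \<otimes> e)
        ((e \<otimes> e) \<otimes> e + (x \<otimes> c) \<otimes> z + (e \<otimes> x) \<otimes> z) \<bind> assoc"
    by (simp add: bilinear unit nil tensor_assoc add_ac)
  have counit_right: "(u \<otimes> v) \<bind> (\<lambda>(x, y). cmul (counit K y) (ket x))
      = eps K v \<bind> (\<lambda>_. u)" for u v
    by (simp add: lin_tensor lin_swap[of u] lin_fun_cmul lin_ket_right lin_counit)
  have counit_left: "(u \<otimes> v) \<bind> (\<lambda>(x, y). cmul (counit K x) (ket y))
      = eps K u \<bind> (\<lambda>_. v)" for u v
    by (simp add: lin_tensor lin_fun_cmul lin_ket_right lin_counit)
  show ?thesis
    unfolding is_twist_def e_def[symmetric] right left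
    using in_vec inverse cocycle
    by (simp add: counit_right counit_left counit_e counit_x counit_z) blast
qed

section \<open>Bosonization at grouplike elements\<close>

text \<open>
  When \<open>g\<close> is grouplike its two Sweedler components separate, so that the product of \<open>r # g\<close>
  with a pure tensor is again a pure tensor, and its coproduct is determined by \<open>\<Delta>(r)\<close> and the
  coaction.  All tensor factors met in the twist conditions have this form.
\<close>

lemma mul_bosonization:
  assumes "g \<bind> comult H = g \<otimes> g"
  shows "mul (bosonization R H) (r \<otimes> g) (s \<otimes> h)
    = mul R r ((g \<otimes> s) \<bind> act (ydmod R)) \<otimes> mul H g h"
proof -
  define F where "F r s h h1 h2 = mul R (ket r) (act (ydmod R) (h1, s)) \<otimes> mult H (h2, h)"
    for r s h h1 h2
  have "mul (bosonization R H) (r \<otimes> g) (s \<otimes> h)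
      = r \<bind> (\<lambda>r. g \<bind> (\<lambda>x. s \<bind> (\<lambda>s. h \<bind> (\<lambda>h. comult H x \<bind> (\<lambda>(h1, h2). F r s h h1 h2)))))"
    unfolding mul_lin[of "bosonization R H"] lin_tensor by (simp add: bosonization_def F_def)
  also have "\<dots> = r \<bind> (\<lambda>r. s \<bind> (\<lambda>s. h \<bind> (\<lambda>h. g \<bind> comult H \<bind> (\<lambda>(h1, h2). F r s h h1 h2))))"
    by (simp add: lin_swap[of g] lin_assoc)
  also have "\<dots> = r \<bind> (\<lambda>r. s \<bind> (\<lambda>s. h \<bind> (\<lambda>h. g \<bind> (\<lambda>h1. g \<bind> (\<lambda>h2. F r s h h1 h2)))))"
    by (simp add: assms lin_tensor)
  also have "\<dots> = r \<bind> (\<lambda>r. g \<bind> (\<lambda>h1. s \<bind> (\<lambda>s. g \<bind> (\<lambda>h2. h \<bind> (\<lambda>h. F r s h h1 h2)))))"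
    by (simp add: lin_swap[of h g] lin_swap[of s g])
  also have "\<dots> = mul R r ((g \<otimes> s) \<bind> act (ydmod R)) \<otimes> mul H g h"
    by (simp add: F_def mul_lin lin_tensor lin_assoc lin_tensor_left)
       (simp add: lin_tensor_right lin_swap[of "act (ydmod R) p" for p])
  finally show ?thesis .
qed

lemma comult_bosonization:
  fixes H :: "('h, 'k::field, 'z) bialg_scheme" and R :: "('b, 'h, 'k, 'y) yd_bialg_scheme"
  assumes "g \<bind> comult H = g \<otimes> g"
  shows "(r \<otimes> g) \<bind> comult (bosonization R H)
    = r \<bind> comult R \<bind> (\<lambda>(r1, r2). coact (ydmod R) r2 \<bind>
        (\<lambda>(c, r0). (ket r1 \<otimes> mul H (ket c) g) \<otimes> (ket r0 \<otimes> g)))"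
proof -
  define G where "G r1 c r0 = (\<lambda>(h1, h2 :: 'h). (ket r1 \<otimes> mult H (c, h1)) \<otimes> (ket r0 \<otimes> ket h2))"
    for r1 r0 :: 'b and c :: 'h
  have G: "g \<bind> comult H \<bind> G r1 c r0 = (ket r1 \<otimes> mul H (ket c) g) \<otimes> (ket r0 \<otimes> g)" for r1 c r0
  proof -
    have "g \<bind> comult H \<bind> G r1 c r0
        = g \<bind> (\<lambda>h1. (ket r1 \<otimes> mult H (c, h1)) \<otimes> (ket r0 \<otimes> (g \<bind> ket)))"
      by (simp add: assms lin_tensor G_def lin_tensor_right)
    also have "\<dots> = (ket r1 \<otimes> mul H (ket c) g) \<otimes> (ket r0 \<otimes> g)"
      by (simp add: lin_ket_right mul_lin lin_tensor_left lin_tensor_right)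
    finally show ?thesis .
  qed
  have "(r \<otimes> g) \<bind> comult (bosonization R H)
      = r \<bind> (\<lambda>r. g \<bind> (\<lambda>h. comult R r \<bind> (\<lambda>(r1, r2). coact (ydmod R) r2 \<bind>
          (\<lambda>(c, r0). comult H h \<bind> G r1 c r0))))"
    by (simp add: lin_tensor bosonization_def G_def)
  also have "\<dots> = r \<bind> (\<lambda>r. comult R r \<bind> (\<lambda>(r1, r2). coact (ydmod R) r2 \<bind>
          (\<lambda>(c, r0). g \<bind> (\<lambda>h. comult H h \<bind> G r1 c r0))))"
    by (simp add: lin_swap[of g] case_prod_unfold)
  also have "\<dots> = r \<bind> (\<lambda>r. comult R r \<bind> (\<lambda>(r1, r2). coact (ydmod R) r2 \<bind>
          (\<lambda>(c, r0). g \<bind> comult H \<bind> G r1 c r0)))"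
    by (simp add: lin_assoc)
  finally show ?thesis
    unfolding G by (simp add: lin_assoc)
qed

text \<open>
  Evaluates the right-hand side of \<open>comult_bosonization\<close> on one pure tensor summand
  \<open>r \<otimes> s\<close> of a coproduct whose second factor spans a subcomodule.
\<close>

lemma comult_bosonization_summand:
  assumes "s \<bind> coact (ydmod R) = c \<otimes> s"
  shows "(r \<otimes> s) \<bind> (\<lambda>(r1, r2). coact (ydmod R) r2 \<bind>
        (\<lambda>(c, r0). (ket r1 \<otimes> mul H (ket c) g) \<otimes> (ket r0 \<otimes> g)))
    = (r \<otimes> mul H c g) \<otimes> (s \<otimes> g)"
proof -
  have "(r \<otimes> s) \<bind> (\<lambda>(r1, r2). coact (ydmod R) r2 \<bind>
        (\<lambda>(c, r0). (ket r1 \<otimes> mul H (ket c) g) \<otimes> (ket r0 \<otimes> g)))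
    = r \<bind> (\<lambda>r1. s \<bind> coact (ydmod R) \<bind>
        (\<lambda>(c, r0). (ket r1 \<otimes> mul H (ket c) g) \<otimes> (ket r0 \<otimes> g)))"
    by (simp add: lin_tensor lin_assoc)
  also have "\<dots> = r \<bind> (\<lambda>r1. c \<bind> (\<lambda>c. (ket r1 \<otimes> mul H (ket c) g) \<otimes> ((s \<bind> ket) \<otimes> g)))"
    by (simp add: assms lin_tensor lin_tensor_left lin_tensor_right)
  also have "\<dots> = ((r \<bind> ket) \<otimes> mul H c g) \<otimes> (s \<otimes> g)"
    by (simp add: lin_ket_right[of s] lin_tensor_left)
       (simp add: mul_lin lin_tensor_left lin_tensor_right)
  finally show ?thesis
    by (simp add: lin_ket_right)
qed

lemma mul_braided_tensor_alg:
  assumes "s \<bind> coact (ydmod R) = c \<otimes> s"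
  shows "mul (braided_tensor_alg R) (r \<otimes> s) (r' \<otimes> s')
    = mul R r ((c \<otimes> r') \<bind> act (ydmod R)) \<otimes> mul R s s'"
proof -
  define F where "F r r' s' = (\<lambda>(g, s0). mul R (ket r) (act (ydmod R) (g, r')) \<otimes> mult R (s0, s'))"
    for r r' s'
  have "mul (braided_tensor_alg R) (r \<otimes> s) (r' \<otimes> s')
    = r \<bind> (\<lambda>r. s \<bind> (\<lambda>s. r' \<bind> (\<lambda>r'. s' \<bind> (\<lambda>s'. coact (ydmod R) s \<bind> F r r' s'))))"
    unfolding mul_lin[of "braided_tensor_alg R"] lin_tensor
    by (simp add: braided_tensor_alg_def F_def)
  also have "\<dots> = r \<bind> (\<lambda>r. r' \<bind> (\<lambda>r'. s' \<bind> (\<lambda>s'. s \<bind> coact (ydmod R) \<bind> F r r' s')))"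
    by (simp add: lin_swap[of s] lin_assoc)
  also have "\<dots> = r \<bind> (\<lambda>r. r' \<bind> (\<lambda>r'. s' \<bind> (\<lambda>s'. c \<bind> (\<lambda>g. s \<bind> (\<lambda>s0. F r r' s' (g, s0))))))"
    by (simp add: assms lin_tensor)
  also have "\<dots> = r \<bind> (\<lambda>r. c \<bind> (\<lambda>g. r' \<bind> (\<lambda>r'. s \<bind> (\<lambda>s0. s' \<bind> (\<lambda>s'. F r r' s' (g, s0))))))"
    by (simp add: lin_swap[of s' c] lin_swap[of r' c] lin_swap[of s' s])
  also have "\<dots> = mul R r ((c \<otimes> r') \<bind> act (ydmod R)) \<otimes> mul R s s'"
    by (simp add: F_def mul_lin lin_tensor lin_assoc lin_tensor_left)
       (simp add: lin_tensor_right lin_swap[of "act (ydmod R) p" for p])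
  finally show ?thesis .
qed

lemma eps_bosonization:
  assumes "eps H g = ket ()"
  shows "eps (bosonization R H) (r \<otimes> g) = eps R r"
proof -
  have "eps (bosonization R H) (r \<otimes> g) = r \<bind> (\<lambda>r. cmul (counit R r) (eps H g))"
    by (simp add: eps_def lin_tensor bosonization_def lin_fun_cmul flip: cmul_simps(3))
  then show ?thesis
    by (simp add: assms) (simp add: eps_def)
qed

section \<open>Braided Hopf algebras\<close>

lemma unit_act:
  assumes "is_yd_hopf H R" "v \<in> vec (basis R)"
  shows "(unit_vec H \<otimes> v) \<bind> act (ydmod R) = v"
proof -
  have "(unit_vec H \<otimes> v) \<bind> act (ydmod R)
      = v \<bind> (\<lambda>m. unit_vec H \<bind> (\<lambda>h. act (ydmod R) (h, m)))"
    by (simp add: lin_tensor lin_swap[of "unit_vec H"])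
  also have "\<dots> = v \<bind> ket"
    using assms by (intro lin_cong[of _ "basis R"]) (auto simp: is_yd_hopf_def is_yd_def)
  finally show ?thesis
    by (simp add: lin_ket_right)
qed

text \<open>
  The unit of \<open>R\<close> is a morphism from the trivial module, so elements of counit 1 fix it, and it is
  coacted on trivially; this disposes of the terms with a factor 1 in the computations below.
\<close>

lemma act_unit:
  assumes "is_yd_hopf H R" "g \<in> vec (basis H)" "eps H g = ket ()"
  shows "(g \<otimes> unit_vec R) \<bind> act (ydmod R) = unit_vec R"
proof -
  have "(g \<otimes> unit_vec R) \<bind> act (ydmod R) = g \<bind> (\<lambda>h. cmul (counit H h) (unit_vec R))"
    unfolding lin_tensor using assms
    by (intro lin_cong[of _ "basis H"]) (auto simp: is_yd_hopf_def yd_hom_def yd_unit_def)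
  then show ?thesis
    by (simp add: lin_counit assms)
qed

lemma coact_unit:
  assumes "is_yd_hopf H R"
  shows "unit_vec R \<bind> coact (ydmod R) = unit_vec H \<otimes> unit_vec R"
  using assms
  by (simp add: is_yd_hopf_def yd_hom_def yd_unit_def lin_tensor lin_ket_right
      flip: lin_tensor_left)

lemma unit_in_vec: "is_yd_hopf H R \<Longrightarrow> unit_vec R \<in> vec (basis R)"
  and mul_unit: "is_yd_hopf H R \<Longrightarrow> v \<in> vec (basis R) \<Longrightarrow> mul R (unit_vec R) v = v"
    "is_yd_hopf H R \<Longrightarrow> v \<in> vec (basis R) \<Longrightarrow> mul R v (unit_vec R) = v"
  and comult_unit: "is_yd_hopf H R \<Longrightarrow> unit_vec R \<bind> comult R = unit_vec R \<otimes> unit_vec R"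
  and eps_unit: "is_yd_hopf H R \<Longrightarrow> eps R (unit_vec R) = ket ()"
  by (simp_all add: is_yd_hopf_def is_algebra_def eps_def)

text \<open>
  Expanding \<open>\<Delta>(a)\<Delta>(a) = (a \<otimes> 1 + 1 \<otimes> a)\<^sup>2\<close> in the braided tensor square, the cross terms are
  \<open>a \<otimes> a\<close> and \<open>(c \<cdot> a) \<otimes> a\<close>, which cancel.
\<close>

lemma anticommuting_primitive_square:
  assumes R: "is_yd_hopf H R"
    and c: "c \<in> vec (basis H)" "eps H c = ket ()"
    and a: "a \<in> primitives R" "a \<bind> coact (ydmod R) = c \<otimes> a"
      "(c \<otimes> a) \<bind> act (ydmod R) = - a"
  shows "mul R a a \<in> primitives R"
proof -
  let ?B = "braided_tensor_alg R" and ?e = "unit_vec R"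
  have a_vec: "a \<in> vec (basis R)" and a_comult: "a \<bind> comult R = a \<otimes> ?e + ?e \<otimes> a"
    using a(1) by (auto simp: primitives_def)
  have "mul R a a \<bind> comult R = a \<bind> (\<lambda>r. a \<bind> (\<lambda>s. mul ?B (comult R r) (comult R s)))"
    unfolding mul_lin[of R] lin_assoc using R
    by (intro lin_cong[OF a_vec]) (auto simp: is_yd_hopf_def)
  also have "\<dots> = mul ?B (a \<otimes> ?e + ?e \<otimes> a) (a \<otimes> ?e + ?e \<otimes> a)"
    by (simp add: a_comult flip: mul_lin_lin)
  also have "\<dots> = mul R a a \<otimes> ?e + ?e \<otimes> mul R a a"
    by (simp add: mul_add mul_add_right mul_braided_tensor_alg[OF coact_unit[OF R]]
        mul_braided_tensor_alg[OF a(2)] unit_act[OF R] act_unit[OF R] c a(3) a_vec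
        unit_in_vec[OF R] mul_unit[OF R] mul_uminus_right tensor_uminus)
  finally have "mul R a a \<bind> comult R = mul R a a \<otimes> ?e + ?e \<otimes> mul R a a" .
  moreover have "mul R a a \<in> vec (basis R)"
    unfolding mul_lin using R
    by (intro vec_lin[OF a_vec]) (auto simp: is_yd_hopf_def is_algebra_def linear_map_def)
  ultimately show ?thesis
    by (simp add: primitives_def)
qed

theorem bosonization_twist:
  fixes H :: "('h, 'k::field, 'z) bialg_scheme" and R :: "('b, 'h, 'k, 'y) yd_bialg_scheme"
  defines "e \<equiv> unit_vec (bosonization R H)"
  assumes R: "is_yd_hopf H R"
    and one: "unit_vec H \<in> vec (basis H)" "eps H (unit_vec H) = ket ()"
      "unit_vec H \<bind> comult H = unit_vec H \<otimes> unit_vec H"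
      "mul H (unit_vec H) (unit_vec H) = unit_vec H"
    and c: "c \<in> vec (basis H)" "eps H c = ket ()" "c \<bind> comult H = c \<otimes> c"
      "mul H (unit_vec H) c = c" "mul H c (unit_vec H) = c" "mul H c c = unit_vec H"
    and a: "a \<in> primitives R" "a \<bind> coact (ydmod R) = c \<otimes> a"
      "(c \<otimes> a) \<bind> act (ydmod R) = - a" "eps R a = 0" "mul R a a = 0"
  shows "is_twist (bosonization R H) (e \<otimes> e + (a \<otimes> c) \<otimes> (a \<otimes> unit_vec H))"
proof -
  let ?K = "bosonization R H"
  have e: "e = unit_vec R \<otimes> unit_vec H"
    by (simp add: e_def bosonization_def)
  have a_vec: "a \<in> vec (basis R)"
    and a_comult: "a \<bind> comult R = a \<otimes> unit_vec R + unit_vec R \<otimes> a"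
    using a(1) by (auto simp: primitives_def)
  have basis_K: "basis ?K = basis R \<times> basis H"
    by (simp add: bosonization_def)
  note products = mul_bosonization[OF one(3)] mul_bosonization[OF c(3)]
    unit_act[OF R] act_unit[OF R] unit_in_vec[OF R] mul_unit[OF R] mul_uminus_right
  note coproducts = comult_bosonization[OF one(3)] comult_bosonization[OF c(3)]
    comult_bosonization_summand[OF coact_unit[OF R]] comult_bosonization_summand[OF a(2)]
    comult_unit[OF R] a_comult
  show ?thesis
    unfolding e_def
  proof (rule sweedler_twist[where c = "unit_vec R \<otimes> c"], unfold e_def[symmetric])
    show "e \<in> vec (basis ?K)" "a \<otimes> c \<in> vec (basis ?K)" "a \<otimes> unit_vec H \<in> vec (basis ?K)"
      unfolding e basis_K by (intro vec_tensor a_vec c one unit_in_vec[OF R])+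
    show "mul ?K e u = u" if "u \<in> {e, a \<otimes> c, a \<otimes> unit_vec H, unit_vec R \<otimes> c}" for u
      using that by (auto simp: e products one c a_vec)
    show "mul ?K u e = u" if "u \<in> {e, a \<otimes> c, a \<otimes> unit_vec H}" for u
      using that by (auto simp: e products one c a_vec)
    show "mul ?K (a \<otimes> c) (a \<otimes> c) = 0" "mul ?K (a \<otimes> c) (a \<otimes> unit_vec H) = 0"
      "mul ?K (a \<otimes> unit_vec H) (a \<otimes> c) = 0"
      "mul ?K (a \<otimes> unit_vec H) (a \<otimes> unit_vec H) = 0"
      by (simp_all add: products a a_vec)
    show "e \<bind> comult ?K = e \<otimes> e"
      "(a \<otimes> unit_vec H) \<bind> comult ?K
        = (a \<otimes> unit_vec H) \<otimes> e + (unit_vec R \<otimes> c) \<otimes> (a \<otimes> unit_vec H)"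
      "(a \<otimes> c) \<bind> comult ?K = (a \<otimes> c) \<otimes> (unit_vec R \<otimes> c) + e \<otimes> (a \<otimes> c)"
      by (simp_all add: e coproducts one c)
    show "eps ?K e = ket ()" "eps ?K (a \<otimes> c) = 0" "eps ?K (a \<otimes> unit_vec H) = 0"
      by (simp_all add: e eps_bosonization one c a eps_unit[OF R])
  qed
qed

section \<open>Functions on the symmetric group\<close>

text \<open>
  The unit and the sign character both have this form with \<open>f\<close> multiplicative, which is what
  makes them grouplike; the computations below treat them together.
\<close>

definition delta_sum :: "nat \<Rightarrow> ((nat \<Rightarrow> nat) \<Rightarrow> 'k::field) \<Rightarrow> ((nat \<Rightarrow> nat) \<Rightarrow>\<^sub>0 'k)" where
  "delta_sum n f = (\<Sum>\<omega>\<in>Sym n. cmul (f \<omega>) (ket \<omega>))"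

lemma finite_Sym [simp]: "finite (Sym n)"
  by (simp add: Sym_def finite_permutations)

lemma Sym_closed: "id \<in> Sym n" "\<sigma> \<in> Sym n \<Longrightarrow> \<tau> \<in> Sym n \<Longrightarrow> \<sigma> \<circ> \<tau> \<in> Sym n"
  by (auto simp: Sym_def permutes_id intro: permutes_compose)

lemma delta_sum_in_vec: "delta_sum n f \<in> vec (basis (fun_Sym n))"
  unfolding delta_sum_def by (intro vec_sum vec_cmul) (simp add: fun_Sym_def)

lemma unit_fun_Sym: "unit_vec (fun_Sym n) = delta_sum n (\<lambda>_. 1)"
  by (simp add: fun_Sym_def delta_sum_def)

lemma mul_delta_sum:
  "mul (fun_Sym n) (delta_sum n f) (delta_sum n g) = delta_sum n (\<lambda>\<omega>. f \<omega> * g \<omega>)"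
proof -
  have "mul (fun_Sym n) (delta_sum n f) (delta_sum n g)
      = (\<Sum>\<sigma>\<in>Sym n. \<Sum>\<tau>\<in>Sym n. if \<sigma> = \<tau> then cmul (f \<sigma> * g \<tau>) (ket \<sigma>) else 0)"
    by (simp add: mul_lin delta_sum_def lin_sum fun_Sym_def cmul_sum if_distrib cong: if_cong)
  then show ?thesis
    by (simp add: delta_sum_def)
qed

lemma comult_delta_sum:
  assumes "\<And>\<sigma> \<tau>. \<sigma> \<in> Sym n \<Longrightarrow> \<tau> \<in> Sym n \<Longrightarrow> f (\<sigma> \<circ> \<tau>) = f \<sigma> * f \<tau>"
  shows "delta_sum n f \<bind> comult (fun_Sym n) = delta_sum n f \<otimes> delta_sum n f"
proof -
  let ?P = "Sym n \<times> Sym n" and ?h = "\<lambda>p. cmul (f (fst p \<circ> snd p)) (ket p)"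
  have "delta_sum n f \<bind> comult (fun_Sym n)
      = (\<Sum>\<omega>\<in>Sym n. sum ?h {p \<in> ?P. fst p \<circ> snd p = \<omega>})"
    by (auto simp: delta_sum_def lin_sum fun_Sym_def cmul_sum case_prod_beta intro!: sum.cong)
  \<comment> \<open>every pair \<open>(\<sigma>, \<tau>)\<close> occurs once, in the coproduct of the delta function at \<open>\<sigma> \<circ> \<tau>\<close>\<close>
  also have "\<dots> = sum ?h ?P"
    by (rule sum.group) (auto simp: Sym_closed)
  also have "\<dots> = (\<Sum>\<sigma>\<in>Sym n. \<Sum>\<tau>\<in>Sym n. cmul (f \<sigma> * f \<tau>) (ket (\<sigma>, \<tau>)))"
    unfolding sum.cartesian_product by (auto simp: assms intro!: sum.cong)
  also have "\<dots> = delta_sum n f \<otimes> delta_sum n f"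
    by (simp add: delta_sum_def tensor_sum tensor_sum_right cmul_sum)
       (subst sum.swap, simp add: mult.commute)
  finally show ?thesis .
qed

lemma eps_delta_sum: "eps (fun_Sym n) (delta_sum n f) = cmul (f id) (ket ())"
proof -
  have "eps (fun_Sym n) (delta_sum n f)
      = (\<Sum>\<omega>\<in>Sym n. if \<omega> = id then cmul (f id) (ket ()) else 0)"
    unfolding eps_def delta_sum_def lin_sum by (intro sum.cong) (auto simp: fun_Sym_def)
  then show ?thesis
    by (simp add: Sym_closed)
qed

abbreviation sgn_Sym :: "(nat \<Rightarrow> nat) \<Rightarrow> 'k::field" where
  "sgn_Sym \<omega> \<equiv> of_int (sign \<omega>)"

lemma sgn_Sym_compose:
  assumes "\<sigma> \<in> Sym n" "\<tau> \<in> Sym n"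
  shows "sgn_Sym (\<sigma> \<circ> \<tau>) = sgn_Sym \<sigma> * (sgn_Sym \<tau> :: 'k::field)"
proof -
  have "permutation \<sigma>" "permutation \<tau>"
    using assms by (auto simp: Sym_def permutation_permutes)
  then show ?thesis
    by (simp add: sign_compose)
qed

lemma sgn_Sym_square: "sgn_Sym \<omega> * sgn_Sym \<omega> = (1 :: 'k::field)"
  by (simp add: sign_def)

lemma transposition_in_Sym: "\<eta> \<in> transpositions n \<Longrightarrow> \<eta> \<in> Sym n"
  and sgn_transposition: "\<eta> \<in> transpositions n \<Longrightarrow> sgn_Sym \<eta> = (- 1 :: 'k::field)"
  by (auto simp: transpositions_def Sym_def sign_swap_id permutes_swap_id)

lemma conj_transposition:
  assumes "\<omega> \<in> Sym n" "\<eta> \<in> transpositions n"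
  shows "inv \<omega> \<circ> \<eta> \<circ> \<omega> \<in> transpositions n"
proof -
  from assms obtain i j where ij: "\<eta> = transpose i j" "i \<in> {1..n}" "j \<in> {1..n}" "i \<noteq> j"
    by (auto simp: transpositions_def)
  have \<omega>: "\<omega> permutes {1..n}" and inv: "inv \<omega> permutes {1..n}"
    using assms by (auto simp: Sym_def permutes_inv)
  have "inv \<omega> \<circ> \<eta> \<circ> \<omega> = transpose (inv \<omega> i) (inv \<omega> j)"
    unfolding ij using permutes_bij[OF \<omega>]
    by (auto simp: fun_eq_iff transpose_def bij_inv_eq_iff bij_is_inj bij_is_surj surj_f_inv_f)
  moreover have "inv \<omega> i \<in> {1..n}" "inv \<omega> j \<in> {1..n}" "inv \<omega> i \<noteq> inv \<omega> j"
    using ij permutes_in_image[OF inv] permutes_inj[OF inv] by (auto simp: inj_eq)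
  ultimately show ?thesis
    by (auto simp: transpositions_def)
qed

lemma sum_conj_transpositions:
  assumes "\<omega> \<in> Sym n"
  shows "(\<Sum>\<tau>\<in>transpositions n. f (inv \<omega> \<circ> \<tau> \<circ> \<omega>)) = sum f (transpositions n)"
proof (rule sum.reindex_bij_witness[of _ "\<lambda>\<tau>. \<omega> \<circ> \<tau> \<circ> inv \<omega>" "\<lambda>\<tau>. inv \<omega> \<circ> \<tau> \<circ> \<omega>"])
  have \<omega>: "\<omega> permutes {1..n}"
    using assms by (simp add: Sym_def)
  note inverses = permutes_inv_o[OF \<omega>] permutes_inverses[OF \<omega>]
  fix \<tau> assume \<tau>: "\<tau> \<in> transpositions n"
  show "\<omega> \<circ> (inv \<omega> \<circ> \<tau> \<circ> \<omega>) \<circ> inv \<omega> = \<tau>" "inv \<omega> \<circ> (\<omega> \<circ> \<tau> \<circ> inv \<omega>) \<circ> \<omega> = \<tau>"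
    by (simp_all add: fun_eq_iff inverses)
  show "inv \<omega> \<circ> \<tau> \<circ> \<omega> \<in> transpositions n"
    using assms \<tau> by (rule conj_transposition)
  have "inv \<omega> \<in> Sym n" "inv (inv \<omega>) = \<omega>"
    using \<omega> by (auto simp: Sym_def permutes_inv permutes_inv_inv)
  then show "\<omega> \<circ> \<tau> \<circ> inv \<omega> \<in> transpositions n"
    using conj_transposition[of "inv \<omega>" n \<tau>] \<tau> by simp
qed simp

section \<open>The Fomin-Kirillov twist\<close>

theorem proposition5p10:
  fixes n :: nat
    and R :: "('b, nat \<Rightarrow> nat, 'k::{alg_closed_field, field_char_0}) yd_bialg"
    and deg :: "'b \<Rightarrow> nat"
    and y :: "(nat \<Rightarrow> nat) \<Rightarrow> ('b \<Rightarrow>\<^sub>0 'k)"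
  assumes "n = 3 \<or> n = 4"
    and "is_nichols_algebra (fun_Sym n) (FK_module n) R deg y"
  shows "is_twist (bosonization R (fun_Sym n)) (FK_twist n R y)"
proof -
  let ?H = "fun_Sym n :: (nat \<Rightarrow> nat, 'k) bialg" and ?X = "transpositions n"
  define a where "a = sum y ?X"
  define \<chi> :: "(nat \<Rightarrow> nat) \<Rightarrow>\<^sub>0 'k" where "\<chi> = delta_sum n sgn_Sym"
  have R: "is_yd_hopf ?H R"
    and graded: "\<And>r s. r \<in> basis R \<Longrightarrow> s \<in> basis R
        \<Longrightarrow> mult R (r, s) \<in> homogeneous R deg (deg r + deg s)"
      "\<And>r. r \<in> basis R \<Longrightarrow> deg r > 0 \<Longrightarrow> counit R r = 0"
    and hom: "yd_hom ?H (FK_module n) (ydmod R) y"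
    and bij: "bij_betw (\<lambda>v. v \<bind> y)
        (vec (ybasis (FK_module n :: (nat \<Rightarrow> nat, nat \<Rightarrow> nat, 'k) yd))) (homogeneous R deg 1)"
    and primitives: "primitives R = homogeneous R deg 1"
    using assms(2) by (auto simp: is_nichols_algebra_def is_graded_yd_hopf_def)
  have a_deg: "a \<in> homogeneous R deg 1"
    unfolding a_def homogeneous_def
  proof (rule vec_sum)
    fix \<eta> assume "\<eta> \<in> ?X"
    then have "ket \<eta> \<bind> y \<in> homogeneous R deg 1"
      by (intro bij_betwE[OF bij, rule_format]) (simp add: FK_module_def)
    then show "y \<eta> \<in> vec {b \<in> basis R. deg b = 1}"
      by (simp add: homogeneous_def)
  qed
  have a_act: "(\<chi> \<otimes> a) \<bind> act (ydmod R) = - a"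
  proof -
    have "(\<chi> \<otimes> y \<eta>) \<bind> act (ydmod R) = - y \<eta>" if \<eta>: "\<eta> \<in> ?X" for \<eta>
    proof -
      \<comment> \<open>\<open>y \<eta>\<close> lives over \<open>\<eta>\<close>, so \<open>\<chi>\<close> acts on it by its value at \<open>\<eta>\<close>\<close>
      have "(\<chi> \<otimes> y \<eta>) \<bind> act (ydmod R)
          = (\<Sum>\<omega>\<in>Sym n. cmul (sgn_Sym \<omega>) (y \<eta> \<bind> (\<lambda>x. act (ydmod R) (\<omega>, x))))"
        by (simp add: \<chi>_def delta_sum_def lin_tensor lin_sum)
      also have "\<dots> = (\<Sum>\<omega>\<in>Sym n. if \<omega> = \<eta> then cmul (sgn_Sym \<eta>) (y \<eta>) else 0)"
      proof (rule sum.cong[OF refl])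
        fix \<omega> assume "\<omega> \<in> Sym n"
        then have "y \<eta> \<bind> (\<lambda>x. act (ydmod R) (\<omega>, x)) = act (FK_module n) (\<omega>, \<eta>) \<bind> y"
          using hom \<eta> by (simp add: yd_hom_def fun_Sym_def FK_module_def)
        then show "cmul (sgn_Sym \<omega>) (y \<eta> \<bind> (\<lambda>x. act (ydmod R) (\<omega>, x)))
            = (if \<omega> = \<eta> then cmul (sgn_Sym \<eta>) (y \<eta>) else 0)"
          by (simp add: FK_module_def)
      qed
      also have "\<dots> = - y \<eta>"
        using \<eta> by (simp add: transposition_in_Sym sgn_transposition)
      finally show ?thesis .
    qed
    then show ?thesis
      by (simp add: a_def tensor_sum_right lin_sum sum_negf)
  qed
  have a_coact: "a \<bind> coact (ydmod R) = \<chi> \<otimes> a"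
  proof -
    have "y \<eta> \<bind> coact (ydmod R)
        = (\<Sum>\<omega>\<in>Sym n. cmul (sgn_Sym \<omega>) (ket \<omega> \<otimes> y (inv \<omega> \<circ> \<eta> \<circ> \<omega>)))" if "\<eta> \<in> ?X" for \<eta>
      using hom that by (simp add: yd_hom_def FK_module_def lin_sum)
    then have "a \<bind> coact (ydmod R)
        = (\<Sum>\<eta>\<in>?X. \<Sum>\<omega>\<in>Sym n. cmul (sgn_Sym \<omega>) (ket \<omega> \<otimes> y (inv \<omega> \<circ> \<eta> \<circ> \<omega>)))"
      by (simp add: a_def lin_sum)
    also have "\<dots> = (\<Sum>\<omega>\<in>Sym n. cmul (sgn_Sym \<omega>) (ket \<omega> \<otimes> (\<Sum>\<eta>\<in>?X. y (inv \<omega> \<circ> \<eta> \<circ> \<omega>))))"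
      by (subst sum.swap) (simp add: cmul_sum tensor_sum_right)
    also have "\<dots> = \<chi> \<otimes> a"
      by (simp add: sum_conj_transpositions \<chi>_def delta_sum_def a_def tensor_sum)
    finally show ?thesis .
  qed
  have \<chi>: "\<chi> \<in> vec (basis ?H)" "eps ?H \<chi> = ket ()"
    "\<chi> \<bind> comult ?H = \<chi> \<otimes> \<chi>" "mul ?H (unit_vec ?H) \<chi> = \<chi>"
    "mul ?H \<chi> (unit_vec ?H) = \<chi>" "mul ?H \<chi> \<chi> = unit_vec ?H"
    by (simp_all add: \<chi>_def delta_sum_in_vec eps_delta_sum comult_delta_sum sgn_Sym_compose
        mul_delta_sum unit_fun_Sym sgn_Sym_square sign_id)
  have one: "unit_vec ?H \<in> vec (basis ?H)" "eps ?H (unit_vec ?H) = ket ()"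
    "unit_vec ?H \<bind> comult ?H = unit_vec ?H \<otimes> unit_vec ?H"
    "mul ?H (unit_vec ?H) (unit_vec ?H) = unit_vec ?H"
    by (simp_all add: delta_sum_in_vec eps_delta_sum comult_delta_sum mul_delta_sum unit_fun_Sym)
  have a_primitive: "a \<in> primitives R"
    using a_deg by (simp add: primitives)
  have a_square: "mul R a a = 0"
  proof -
    have "mul R a a \<in> homogeneous R deg 1"
      using anticommuting_primitive_square[OF R \<chi>(1,2) a_primitive a_coact a_act]
      by (simp add: primitives)
    moreover have "mul R a a \<in> homogeneous R deg 2"
      unfolding mul_lin homogeneous_def
      using a_deg[unfolded homogeneous_def]
      by (rule vec_lin)
        (rule vec_lin[OF a_deg[unfolded homogeneous_def]], use graded(1) in
          \<open>force simp: homogeneous_def numeral_2_eq_2\<close>)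
    ultimately have "Poly_Mapping.keys (mul R a a) = {}"
      by (fastforce simp: homogeneous_def vec_def)
    then show ?thesis
      by simp
  qed
  have a_eps: "eps R a = 0"
  proof -
    have "eps R a = a \<bind> (\<lambda>_. 0)"
      unfolding eps_def
      using a_deg[unfolded homogeneous_def] by (rule lin_cong) (simp add: graded(2))
    then show ?thesis
      by simp
  qed
  have "FK_twist n R y = unit_vec (bosonization R ?H) \<otimes> unit_vec (bosonization R ?H)
      + (\<Sum>\<omega>\<in>Sym n. cmul (sgn_Sym \<omega>) ((a \<otimes> ket \<omega>) \<otimes> (a \<otimes> unit_vec ?H)))"
    unfolding FK_twist_def
    by (simp add: sum_conj_transpositions a_def flip: tensor_sum tensor_sum_right)
  also have "\<dots> = unit_vec (bosonization R ?H) \<otimes> unit_vec (bosonization R ?H)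
      + (a \<otimes> \<chi>) \<otimes> (a \<otimes> unit_vec ?H)"
    by (simp add: \<chi>_def delta_sum_def tensor_sum tensor_sum_right)
  finally show ?thesis
    using bosonization_twist[OF R one \<chi> a_primitive a_coact a_act a_eps a_square] by simp
qed

end
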